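(* Let $\mathcal{X}$ and $\mathcal{Y}$ be nonzero linear spaces over a field $\mathbb{F}$, and let $\mathcal{F}$ be an arbitrary but fixed nonzero linear space over $\mathbb{F}$. For each $(x,y)\in\mathcal{X}\times\mathcal{Y}$ let $x\otimes y\in\mathcal{L}[\,b[\mathcal{X}\times\mathcal{Y},\mathcal{F}],\mathcal{F}]$ be the linear transformation defined by $$(x\otimes y)(\psi)=\psi(x,y)\in\mathcal{F}\quad\text{for every}\quad\psi\in b[\mathcal{X}\times\mathcal{Y},\mathcal{F}].$$ Let $$\top_{\mathcal{X},\mathcal{Y},\mathcal{F}}=\{x\otimes y\in\mathcal{L}[\,b[\mathcal{X}\times\mathcal{Y},\mathcal{F}],\mathcal{F}]:\ x\in\mathcal{X}\ \text{and}\ y\in\mathcal{Y}\},$$ and define $\theta:\mathcal{X}\times\mathcal{Y}\to\operatorname{span}\top_{\mathcal{X},\mathcal{Y},\mathcal{F}}$ by $\theta(x,y)=x\otimes y$. Then $(\operatorname{span}\top_{\mathcal{X},\mathcal{Y},\mathcal{F}},\theta)$ is a tensor product of $\mathcal{X}$ and $\mathcal{Y}$.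
   Context: $\mathcal{L}[\mathcal{U},\mathcal{Z}]$ denotes the linear space of all linear transformations from $\mathcal{U}$ to $\mathcal{Z}$, and $b[\mathcal{X}\times\mathcal{Y},\mathcal{Z}]$ denotes the linear space of all bilinear maps $\mathcal{X}\times\mathcal{Y}\to\mathcal{Z}$ (pointwise operations). Definition (tensor product). Let $\mathcal{X}$ and $\mathcal{Y}$ be nonzero linear spaces over $\mathbb{F}$. A tensor product of $\mathcal{X}$ and $\mathcal{Y}$ is a pair $(\mathcal{T},\theta)$ consisting of a linear space $\mathcal{T}$ over $\mathbb{F}$ and a bilinear map $\theta:\mathcal{X}\times\mathcal{Y}\to\mathcal{T}$ such that (a) the range $R(\theta)=\theta(\mathcal{X}\times\mathcal{Y})$ spans $\mathcal{T}$; and (b) for every linear space $\mathcal{Z}$ over $\mathbb{F}$ and every $\phi\in b[\mathcal{X}\times\mathcal{Y},\mathcal{Z}]$ there is a linear transformation $\Phi\in\mathcal{L}[\mathcal{T},\mathcal{Z}]$ with $\phi=\Phi\circ\theta$. *)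

theory Defs
  imports "Jordan_Normal_Form.Missing_VectorSpace"
begin

definition nonzero_vectorspace ::
    "('k, 'm) ring_scheme \<Rightarrow> ('k, 'v, 'n) module_scheme \<Rightarrow> bool" where
  "nonzero_vectorspace K V \<longleftrightarrow> vectorspace K V \<and> carrier V \<noteq> {\<zero>\<^bsub>V\<^esub>}"

text \<open>A set \<open>S\<close> of maps \<open>D \<rightarrow> Z\<close> with the pointwise operations. Maps are taken extensional
  on \<open>D\<close>, so that HOL equality of two maps is equality on \<open>D\<close>. The fields \<open>mult\<close> and
  \<open>one\<close> are inherited from the ring record and play no role in a module.\<close>
definition pointwise_space ::
    "('d \<Rightarrow> 'z) set \<Rightarrow> 'd set \<Rightarrow> ('k, 'z, 'n) module_scheme \<Rightarrow> ('k, 'd \<Rightarrow> 'z) module" where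
  "pointwise_space S D Z =
     \<lparr>carrier = S,
      mult = (\<lambda>f g. \<lambda>v\<in>D. \<zero>\<^bsub>Z\<^esub>),
      one = (\<lambda>v\<in>D. \<zero>\<^bsub>Z\<^esub>),
      zero = (\<lambda>v\<in>D. \<zero>\<^bsub>Z\<^esub>),
      add = (\<lambda>f g. \<lambda>v\<in>D. f v \<oplus>\<^bsub>Z\<^esub> g v),
      smult = (\<lambda>c f. \<lambda>v\<in>D. c \<odot>\<^bsub>Z\<^esub> f v)\<rparr>"

definition linear_maps ::
    "('k, 'm) ring_scheme \<Rightarrow> ('k, 'u, 'n1) module_scheme \<Rightarrow> ('k, 'z, 'n2) module_scheme
      \<Rightarrow> ('k, 'u \<Rightarrow> 'z) module" where
  "linear_maps K U Z =
     pointwise_space (module_hom K U Z \<inter> extensional (carrier U)) (carrier U) Z"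

definition bilinear_maps ::
    "('k, 'm) ring_scheme \<Rightarrow> ('k, 'x, 'n1) module_scheme \<Rightarrow> ('k, 'y, 'n2) module_scheme
      \<Rightarrow> ('k, 'z, 'n3) module_scheme \<Rightarrow> ('k, 'x \<times> 'y \<Rightarrow> 'z) module" where
  "bilinear_maps K X Y Z =
     pointwise_space
       {\<phi> \<in> extensional (carrier X \<times> carrier Y).
          (\<forall>y\<in>carrier Y. (\<lambda>x. \<phi> (x, y)) \<in> module_hom K X Z) \<and>
          (\<forall>x\<in>carrier X. (\<lambda>y. \<phi> (x, y)) \<in> module_hom K Y Z)}
       (carrier X \<times> carrier Y) Z"

lemma vectorspace_pointwise_space:
  assumes Z: "vectorspace K Z" and S: "S \<subseteq> D \<rightarrow>\<^sub>E carrier Z"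
    and zero: "(\<lambda>v\<in>D. \<zero>\<^bsub>Z\<^esub>) \<in> S"
    and add: "\<And>f g. f \<in> S \<Longrightarrow> g \<in> S \<Longrightarrow> (\<lambda>v\<in>D. f v \<oplus>\<^bsub>Z\<^esub> g v) \<in> S"
    and smult: "\<And>c f. c \<in> carrier K \<Longrightarrow> f \<in> S \<Longrightarrow> (\<lambda>v\<in>D. c \<odot>\<^bsub>Z\<^esub> f v) \<in> S"
  shows "vectorspace K (pointwise_space S D Z)"
proof -
  interpret Z: vectorspace K Z by (fact Z)
  have val: "f v \<in> carrier Z" if "f \<in> S" "v \<in> D" for f v
    using that S by (auto dest: subsetD PiE_mem)
  have ext: "f \<in> extensional D" if "f \<in> S" for f
    using that S by (auto simp: PiE_def)
  show ?thesis
  proof (rule vs_criteria)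
    show "field K" by (rule Z.field_axioms)
    show "\<forall>v\<in>carrier (pointwise_space S D Z). \<exists>n\<in>carrier (pointwise_space S D Z).
        v \<oplus>\<^bsub>pointwise_space S D Z\<^esub> n = \<zero>\<^bsub>pointwise_space S D Z\<^esub>"
    proof
      fix f assume "f \<in> carrier (pointwise_space S D Z)"
      then have f: "f \<in> S" by (simp add: pointwise_space_def)
      define n where "n = (\<lambda>v\<in>D. (\<ominus>\<^bsub>K\<^esub> \<one>\<^bsub>K\<^esub>) \<odot>\<^bsub>Z\<^esub> f v)"
      have "n \<in> S" unfolding n_def using f by (intro smult) auto
      moreover have "f v \<oplus>\<^bsub>Z\<^esub> n v = \<zero>\<^bsub>Z\<^esub>" if "v \<in> D" for v
        using that val[OF f that]
        by (simp add: n_def Z.smult_l_minus Z.M.r_neg)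
      ultimately show "\<exists>n\<in>carrier (pointwise_space S D Z).
          f \<oplus>\<^bsub>pointwise_space S D Z\<^esub> n = \<zero>\<^bsub>pointwise_space S D Z\<^esub>"
        by (intro bexI[of _ n]) (auto simp: pointwise_space_def fun_eq_iff restrict_def)
    qed
  qed (auto simp: pointwise_space_def zero add smult val Z.M.a_ac Z.smult_l_distr
        Z.smult_r_distr Z.smult_assoc1 intro!: extensionalityI[of _ D] restrict_extensional
        intro: ext)
qed

lemma vectorspace_linear_maps:
  assumes U: "vectorspace K U" and Z: "vectorspace K Z"
  shows "vectorspace K (linear_maps K U Z)"
proof -
  interpret U: vectorspace K U by (fact U)
  interpret Z: vectorspace K Z by (fact Z)
  show ?thesis unfolding linear_maps_def
    by (rule vectorspace_pointwise_space[OF Z])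
      (auto simp: module_hom_def PiE_def Pi_iff Z.M.a_ac Z.smult_r_distr Z.smult_assoc1[symmetric]
        U.m_comm)
qed

lemma vectorspace_bilinear_maps:
  assumes X: "vectorspace K X" and Y: "vectorspace K Y" and Z: "vectorspace K Z"
  shows "vectorspace K (bilinear_maps K X Y Z)"
proof -
  interpret X: vectorspace K X by (fact X)
  interpret Y: vectorspace K Y by (fact Y)
  interpret Z: vectorspace K Z by (fact Z)
  show ?thesis unfolding bilinear_maps_def
    by (rule vectorspace_pointwise_space[OF Z])
      (auto simp: module_hom_def PiE_def Pi_iff Z.M.a_ac Z.smult_r_distr Z.smult_assoc1[symmetric]
        X.m_comm)
qed

text \<open>The universal property ranges over all linear spaces \<open>Z\<close> over \<open>K\<close> with carrier in the
  type \<open>'z\<close>. HOL cannot quantify over types inside a formula; a theorem in which \<open>'z\<close> is a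
  free type variable covers every linear space \<open>Z\<close>.\<close>
definition is_tensor_product ::
    "'z itself \<Rightarrow> ('k, 'm) ring_scheme \<Rightarrow> ('k, 'x, 'n1) module_scheme
      \<Rightarrow> ('k, 'y, 'n2) module_scheme \<Rightarrow> ('k, 't, 'n3) module_scheme \<Rightarrow> ('x \<times> 'y \<Rightarrow> 't) \<Rightarrow> bool" where
  "is_tensor_product (_ :: 'z itself) K X Y T \<theta> \<longleftrightarrow>
     nonzero_vectorspace K X \<and> nonzero_vectorspace K Y \<and>
     vectorspace K T \<and>
     \<theta> \<in> carrier (bilinear_maps K X Y T) \<and>
     LinearCombinations.module.span K T (\<theta> ` (carrier X \<times> carrier Y)) = carrier T \<and>
     (\<forall>Z :: ('k, 'z) module. vectorspace K Z \<longrightarrow>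
        (\<forall>\<phi> \<in> carrier (bilinear_maps K X Y Z).
           \<exists>\<Phi> \<in> carrier (linear_maps K T Z).
             \<phi> = compose (carrier X \<times> carrier Y) \<Phi> \<theta>))"

text \<open>The evaluation functional \<open>x \<otimes> y\<close> on \<open>b[X \<times> Y, F]\<close>.\<close>
definition single_tensor ::
    "('k, 'm) ring_scheme \<Rightarrow> ('k, 'x, 'n1) module_scheme \<Rightarrow> ('k, 'y, 'n2) module_scheme
      \<Rightarrow> ('k, 'f, 'n3) module_scheme \<Rightarrow> 'x \<Rightarrow> 'y \<Rightarrow> ('x \<times> 'y \<Rightarrow> 'f) \<Rightarrow> 'f" where
  "single_tensor K X Y F x y = (\<lambda>\<psi>\<in>carrier (bilinear_maps K X Y F). \<psi> (x, y))"

lemma single_tensor_in_linear_maps: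
  assumes X: "vectorspace K X" and Y: "vectorspace K Y" and F: "vectorspace K F"
    and xy: "x \<in> carrier X" "y \<in> carrier Y"
  shows "single_tensor K X Y F x y \<in> carrier (linear_maps K (bilinear_maps K X Y F) F)"
proof -
  interpret B: vectorspace K "bilinear_maps K X Y F"
    by (rule vectorspace_bilinear_maps[OF X Y F])
  have val: "\<psi> (x, y) \<in> carrier F" if "\<psi> \<in> carrier (bilinear_maps K X Y F)" for \<psi>
    using that xy by (auto simp: bilinear_maps_def pointwise_space_def module_hom_def Pi_iff)
  have add: "(\<phi> \<oplus>\<^bsub>bilinear_maps K X Y F\<^esub> \<psi>) (x, y) = \<phi> (x, y) \<oplus>\<^bsub>F\<^esub> \<psi> (x, y)" for \<phi> \<psi>
    using xy by (simp add: bilinear_maps_def pointwise_space_def)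
  have smult: "(c \<odot>\<^bsub>bilinear_maps K X Y F\<^esub> \<psi>) (x, y) = c \<odot>\<^bsub>F\<^esub> \<psi> (x, y)" for c \<psi>
    using xy by (simp add: bilinear_maps_def pointwise_space_def)
  have "single_tensor K X Y F x y \<in> module_hom K (bilinear_maps K X Y F) F"
    by (auto simp: module_hom_def single_tensor_def val add smult)
  then show ?thesis
    by (simp add: linear_maps_def pointwise_space_def single_tensor_def)
qed

definition single_tensors ::
    "('k, 'm) ring_scheme \<Rightarrow> ('k, 'x, 'n1) module_scheme \<Rightarrow> ('k, 'y, 'n2) module_scheme
      \<Rightarrow> ('k, 'f, 'n3) module_scheme \<Rightarrow> (('x \<times> 'y \<Rightarrow> 'f) \<Rightarrow> 'f) set" where
  "single_tensors K X Y F = {single_tensor K X Y F x y | x y. x \<in> carrier X \<and> y \<in> carrier Y}"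

definition tensor_space ::
    "('k, 'm) ring_scheme \<Rightarrow> ('k, 'x, 'n1) module_scheme \<Rightarrow> ('k, 'y, 'n2) module_scheme
      \<Rightarrow> ('k, 'f, 'n3) module_scheme \<Rightarrow> ('k, ('x \<times> 'y \<Rightarrow> 'f) \<Rightarrow> 'f) module" where
  "tensor_space K X Y F =
     (let L = linear_maps K (bilinear_maps K X Y F) F
      in L\<lparr>carrier := LinearCombinations.module.span K L (single_tensors K X Y F)\<rparr>)"

definition tensor_map ::
    "('k, 'm) ring_scheme \<Rightarrow> ('k, 'x, 'n1) module_scheme \<Rightarrow> ('k, 'y, 'n2) module_scheme
      \<Rightarrow> ('k, 'f, 'n3) module_scheme \<Rightarrow> 'x \<times> 'y \<Rightarrow> (('x \<times> 'y \<Rightarrow> 'f) \<Rightarrow> 'f)" where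
  "tensor_map K X Y F = (\<lambda>(x, y)\<in>carrier X \<times> carrier Y. single_tensor K X Y F x y)"

end

theory Submission
  imports Defs
begin

text \<open>By Zorn's lemma a maximal subspace avoiding \<open>z \<noteq> 0\<close> is a complement of the line through \<open>z\<close>;
  sending \<open>z\<close> to a nonzero vector of \<open>F\<close> shows that the linear maps \<open>g : Z \<rightarrow> F\<close> separate the
  points of \<open>Z\<close>. Given a bilinear \<open>\<phi> : X \<times> Y \<rightarrow> Z\<close>, every \<open>g \<circ> \<phi>\<close> is in the domain of the
  functionals \<open>t\<close> in the span of the \<open>x \<otimes> y\<close>, so \<open>\<Phi> t\<close> can be defined as the unique \<open>z\<close> with
  \<open>t (g \<circ> \<phi>) = g z\<close> for all \<open>g\<close>. Such a \<open>z\<close> exists for the generators \<open>x \<otimes> y\<close>, namely \<open>\<phi> (x, y)\<close>,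
  hence on their span; uniqueness makes \<open>\<Phi>\<close> linear.\<close>

section \<open>Linear maps into \<open>F\<close> separate points\<close>

lemma module_homD:
  assumes "g \<in> module_hom K V W"
  shows "u \<in> carrier V \<Longrightarrow> g u \<in> carrier W"
    and "u \<in> carrier V \<Longrightarrow> v \<in> carrier V \<Longrightarrow> g (u \<oplus>\<^bsub>V\<^esub> v) = g u \<oplus>\<^bsub>W\<^esub> g v"
    and "c \<in> carrier K \<Longrightarrow> u \<in> carrier V \<Longrightarrow> g (c \<odot>\<^bsub>V\<^esub> u) = c \<odot>\<^bsub>W\<^esub> g u"
  using assms by (auto simp: module_hom_def)

text \<open>Zorn's lemma applies because the zero subspace avoids \<open>z\<close> and the union of
  a chain is again a subspace avoiding \<open>z\<close>: any two of its vectors already lie in one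
  member of the chain.\<close>

lemma (in vectorspace) exists_maximal_submodule_avoiding:
  assumes z: "z \<in> carrier V" "z \<noteq> \<zero>\<^bsub>V\<^esub>"
  obtains W where "submodule K W V" "z \<notin> W"
    "\<And>W'. submodule K W' V \<Longrightarrow> z \<notin> W' \<Longrightarrow> W \<subseteq> W' \<Longrightarrow> W' = W"
proof -
  let ?\<A> = "{W. submodule K W V \<and> z \<notin> W}"
  have "{\<zero>\<^bsub>V\<^esub>} \<in> ?\<A>"
    using z module_axioms by (auto simp: submodule_def)
  then have ne: "?\<A> \<noteq> {}" by blast
  have "\<exists>W\<in>?\<A>. \<forall>W'\<in>?\<A>. W \<subseteq> W' \<longrightarrow> W' = W"
  proof (rule subset_Zorn_nonempty[OF ne])
    fix \<C> assume \<C>: "\<C> \<noteq> {}" "subset.chain ?\<A> \<C>"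
    have mem: "W \<in> ?\<A>" if "W \<in> \<C>" for W
      using \<C>(2) that by (auto simp: subset.chain_def)
    have "u \<oplus>\<^bsub>V\<^esub> v \<in> \<Union>\<C>" if uv: "u \<in> \<Union>\<C>" "v \<in> \<Union>\<C>" for u v
    proof -
      obtain A B where AB: "A \<in> \<C>" "B \<in> \<C>" "u \<in> A" "v \<in> B" using uv by blast
      then have "A \<subseteq> B \<or> B \<subseteq> A" using \<C>(2) by (auto simp: subset.chain_def)
      then obtain C where C: "C \<in> \<C>" "u \<in> C" "v \<in> C" using AB by blast
      with mem[of C] have "u \<oplus>\<^bsub>V\<^esub> v \<in> C" by (simp add: submodule_def)
      with C show ?thesis by blast
    qed
    \<comment> \<open>The chain being nonempty matters here: zero is supplied by any one of its
      members.\<close>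
    moreover have "\<zero>\<^bsub>V\<^esub> \<in> \<Union>\<C>" using \<C>(1) mem by (auto simp: submodule_def)
    moreover have "c \<odot>\<^bsub>V\<^esub> v \<in> \<Union>\<C>" if "c \<in> carrier K" "v \<in> \<Union>\<C>" for c v
      using that mem by (fastforce simp: submodule_def)
    moreover have "\<Union>\<C> \<subseteq> carrier V" using mem by (fastforce simp: submodule_def)
    ultimately have "submodule K (\<Union>\<C>) V"
      using module_axioms by (simp add: submodule_def)
    with mem show "\<Union>\<C> \<in> ?\<A>" by blast
  qed
  then show ?thesis using that by blast
qed

text \<open>Take \<open>W\<close> maximal avoiding \<open>z\<close>. For \<open>v\<close> outside
  \<open>W\<close>, the larger subspace \<open>W + span {v}\<close> must contain \<open>z\<close>,
  so \<open>z = w + c v\<close>. Here \<open>c\<close> is nonzero, since otherwise \<open>z\<close>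
  would lie in \<open>W\<close>; dividing by \<open>c\<close> solves for \<open>v\<close>.\<close>

lemma (in vectorspace) exists_complement_of_line:
  assumes z: "z \<in> carrier V" "z \<noteq> \<zero>\<^bsub>V\<^esub>"
  obtains W where "submodule K W V" "z \<notin> W"
    "\<And>v. v \<in> carrier V \<Longrightarrow> \<exists>a\<in>carrier K. \<exists>w\<in>W. v = w \<oplus>\<^bsub>V\<^esub> a \<odot>\<^bsub>V\<^esub> z"
proof -
  obtain W where W: "submodule K W V" "z \<notin> W"
    and max: "\<And>W'. submodule K W' V \<Longrightarrow> z \<notin> W' \<Longrightarrow> W \<subseteq> W' \<Longrightarrow> W' = W"
    using exists_maximal_submodule_avoiding[OF z] by blast
  note Wc = subsetD[OF submodule.subset[OF W(1)]]
  have "\<exists>a\<in>carrier K. \<exists>w\<in>W. v = w \<oplus>\<^bsub>V\<^esub> a \<odot>\<^bsub>V\<^esub> z" if v: "v \<in> carrier V" for v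
  proof (cases "v \<in> W")
    case True
    then show ?thesis using v z by (intro bexI[of _ "\<zero>\<^bsub>K\<^esub>"] bexI[of _ v]) auto
  next
    case False
    have sp: "submodule K (span {v}) V" using v by (intro span_is_submodule) auto
    let ?W' = "submodule_sum W (span {v})"
    have sub: "submodule K ?W' V" by (rule sum_is_submodule[OF W(1) sp])
    have "W \<subseteq> ?W'" "span {v} \<subseteq> ?W'"
      using in_sum[OF W(1) sp] in_sum[OF sp W(1)] msum_comm[OF W(1) sp] by auto
    moreover have "v \<in> span {v}" using v by (rule span_self)
    \<comment> \<open>If \<open>z\<close> were missing from \<open>?W'\<close>, maximality would
      give \<open>?W' = W\<close>, yet \<open>v\<close> lies only in the former.\<close>
    ultimately have "z \<in> ?W'" using max[OF sub] False by blast
    then obtain w c where w: "w \<in> W" and c: "c \<in> carrier K" and zeq: "z = w \<oplus>\<^bsub>V\<^esub> c \<odot>\<^bsub>V\<^esub> v"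
      using v by (auto simp: submodule_sum_def finite_span lincomb_def)
    note wc = Wc[OF w]
    have "c \<noteq> \<zero>\<^bsub>K\<^esub>" using zeq w W(2) v wc by auto
    then have ic: "inv\<^bsub>K\<^esub> c \<in> carrier K" "inv\<^bsub>K\<^esub> c \<otimes>\<^bsub>K\<^esub> c = \<one>\<^bsub>K\<^esub>"
      using c by (simp_all add: field_Units)
    let ?u = "inv\<^bsub>K\<^esub> c \<odot>\<^bsub>V\<^esub> w"
    have u: "?u \<in> carrier V" using ic wc by simp
    have "inv\<^bsub>K\<^esub> c \<odot>\<^bsub>V\<^esub> z = ?u \<oplus>\<^bsub>V\<^esub> v"
      using zeq ic c v wc by (simp add: smult_r_distr smult_assoc1[symmetric])
    then have "v = \<ominus>\<^bsub>V\<^esub> ?u \<oplus>\<^bsub>V\<^esub> inv\<^bsub>K\<^esub> c \<odot>\<^bsub>V\<^esub> z"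
      using u v by (simp add: M.r_neg1)
    \<comment> \<open>Closure under negation is obtained from scalar multiplication by minus
      one.\<close>
    moreover have "\<ominus>\<^bsub>V\<^esub> ?u \<in> W"
      using submodule.smult_closed[OF W(1) _ submodule.smult_closed[OF W(1) ic(1) w], of "\<ominus>\<^bsub>K\<^esub> \<one>\<^bsub>K\<^esub>"] u
      by (simp add: smult_l_minus)
    ultimately show ?thesis using ic(1) by blast
  qed
  with W show ?thesis using that by blast
qed

text \<open>Relative to a complement \<open>W\<close> of the line through \<open>z\<close>, the
  coefficient of \<open>z\<close> in a vector is a linear functional taking the value one at
  \<open>z\<close>. Multiplying a fixed nonzero \<open>f\<close> in \<open>F\<close> by this
  coefficient gives \<open>g\<close>.\<close>

lemma module_hom_nonzero_value:
  assumes Z: "vectorspace K Z" and F: "nonzero_vectorspace K F"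
    and z: "z \<in> carrier Z" "z \<noteq> \<zero>\<^bsub>Z\<^esub>"
  obtains g where "g \<in> module_hom K Z F" "g z \<noteq> \<zero>\<^bsub>F\<^esub>"
proof -
  interpret Z: vectorspace K Z by (fact Z)
  interpret F: vectorspace K F using F by (simp add: nonzero_vectorspace_def)
  obtain f where f: "f \<in> carrier F" "f \<noteq> \<zero>\<^bsub>F\<^esub>"
    using F F.M.zero_closed unfolding nonzero_vectorspace_def by blast
  obtain W where W: "LinearCombinations.submodule K W Z" "z \<notin> W"
    and dec: "\<And>v. v \<in> carrier Z \<Longrightarrow> \<exists>a\<in>carrier K. \<exists>w\<in>W. v = w \<oplus>\<^bsub>Z\<^esub> a \<odot>\<^bsub>Z\<^esub> z"
    using Z.exists_complement_of_line[OF z] by blast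
  note Wc = subsetD[OF submodule.subset[OF W(1)]]
  have Wadd: "u \<oplus>\<^bsub>Z\<^esub> v \<in> W" if "u \<in> W" "v \<in> W" for u v
    using W(1) that by (simp add: submodule_def)
  have Wsmult: "c \<odot>\<^bsub>Z\<^esub> v \<in> W" if "c \<in> carrier K" "v \<in> W" for c v
    using W(1) that by (simp add: submodule_def)
  \<comment> \<open>If the coefficients differed, \<open>(a - b) z = w - u\<close> would lie in
    \<open>W\<close>, and dividing by the nonzero scalar \<open>a - b\<close> would put
    \<open>z\<close> in \<open>W\<close>.\<close>
  have uniq: "a = b"
    if ab: "a \<in> carrier K" "b \<in> carrier K" and w: "u \<in> W" "w \<in> W"
      and eq: "u \<oplus>\<^bsub>Z\<^esub> a \<odot>\<^bsub>Z\<^esub> z = w \<oplus>\<^bsub>Z\<^esub> b \<odot>\<^bsub>Z\<^esub> z" for a b u w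
  proof (rule ccontr)
    assume "a \<noteq> b"
    let ?d = "a \<ominus>\<^bsub>K\<^esub> b"
    have d: "?d \<in> carrier K" "?d \<noteq> \<zero>\<^bsub>K\<^esub>" using ab \<open>a \<noteq> b\<close> by auto
    then have id: "inv\<^bsub>K\<^esub> ?d \<in> carrier K" "inv\<^bsub>K\<^esub> ?d \<otimes>\<^bsub>K\<^esub> ?d = \<one>\<^bsub>K\<^esub>"
      by (simp_all add: Z.field_Units)
    have neg: "\<ominus>\<^bsub>Z\<^esub> u \<in> W"
      using Wsmult[of "\<ominus>\<^bsub>K\<^esub> \<one>\<^bsub>K\<^esub>" u] w Wc by (simp add: Z.smult_l_minus)
    have "a \<odot>\<^bsub>Z\<^esub> z = (\<ominus>\<^bsub>Z\<^esub> u \<oplus>\<^bsub>Z\<^esub> w) \<oplus>\<^bsub>Z\<^esub> b \<odot>\<^bsub>Z\<^esub> z"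
      using eq ab w z Wc Z.M.r_neg1[of u "a \<odot>\<^bsub>Z\<^esub> z"] by (simp add: Z.M.a_assoc)
    then have "?d \<odot>\<^bsub>Z\<^esub> z = \<ominus>\<^bsub>Z\<^esub> u \<oplus>\<^bsub>Z\<^esub> w"
      using ab w z Wc by (simp add: a_minus_def Z.smult_l_distr Z.smult_l_minus Z.M.a_assoc Z.M.r_neg)
    then have "?d \<odot>\<^bsub>Z\<^esub> z \<in> W" using neg w Wadd by simp
    then have "inv\<^bsub>K\<^esub> ?d \<odot>\<^bsub>Z\<^esub> (?d \<odot>\<^bsub>Z\<^esub> z) \<in> W" using id Wsmult by blast
    then show False using W(2) id d z by (simp add: Z.smult_assoc1[symmetric])
  qed
  obtain a where a: "\<And>v. v \<in> carrier Z \<Longrightarrow> a v \<in> carrier K \<and> (\<exists>w\<in>W. v = w \<oplus>\<^bsub>Z\<^esub> a v \<odot>\<^bsub>Z\<^esub> z)"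
    using dec by metis
  have ac: "a v \<in> carrier K" if "v \<in> carrier Z" for v using a that by blast
  \<comment> \<open>The chosen coefficient can be read off from any decomposition, so linearity of
    \<open>a\<close> only requires exhibiting decompositions of \<open>u + v\<close> and
    \<open>c v\<close>.\<close>
  have coeff: "a v = b" if "b \<in> carrier K" "w \<in> W" "v = w \<oplus>\<^bsub>Z\<^esub> b \<odot>\<^bsub>Z\<^esub> z" for v b w
  proof -
    have "v \<in> carrier Z" using that z Wc by simp
    then show ?thesis using a[of v] uniq that by metis
  qed
  have add: "a (u \<oplus>\<^bsub>Z\<^esub> v) = a u \<oplus>\<^bsub>K\<^esub> a v" if uv: "u \<in> carrier Z" "v \<in> carrier Z" for u v
  proof -
    obtain p q where pq: "p \<in> W" "u = p \<oplus>\<^bsub>Z\<^esub> a u \<odot>\<^bsub>Z\<^esub> z" "q \<in> W" "v = q \<oplus>\<^bsub>Z\<^esub> a v \<odot>\<^bsub>Z\<^esub> z"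
      using a uv by blast
    have "u \<oplus>\<^bsub>Z\<^esub> v = (p \<oplus>\<^bsub>Z\<^esub> a u \<odot>\<^bsub>Z\<^esub> z) \<oplus>\<^bsub>Z\<^esub> (q \<oplus>\<^bsub>Z\<^esub> a v \<odot>\<^bsub>Z\<^esub> z)" using pq by simp
    also have "\<dots> = (p \<oplus>\<^bsub>Z\<^esub> q) \<oplus>\<^bsub>Z\<^esub> (a u \<oplus>\<^bsub>K\<^esub> a v) \<odot>\<^bsub>Z\<^esub> z"
      using pq(1,3) Wc ac uv z by (simp add: Z.smult_l_distr Z.M.a_ac)
    finally show ?thesis using coeff[of _ "p \<oplus>\<^bsub>Z\<^esub> q"] Wadd pq(1,3) ac uv by simp
  qed
  have smult: "a (c \<odot>\<^bsub>Z\<^esub> v) = c \<otimes>\<^bsub>K\<^esub> a v" if cv: "c \<in> carrier K" "v \<in> carrier Z" for c v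
  proof -
    obtain p where p: "p \<in> W" "v = p \<oplus>\<^bsub>Z\<^esub> a v \<odot>\<^bsub>Z\<^esub> z" using a cv by blast
    have "c \<odot>\<^bsub>Z\<^esub> v = c \<odot>\<^bsub>Z\<^esub> (p \<oplus>\<^bsub>Z\<^esub> a v \<odot>\<^bsub>Z\<^esub> z)" using p by simp
    also have "\<dots> = c \<odot>\<^bsub>Z\<^esub> p \<oplus>\<^bsub>Z\<^esub> (c \<otimes>\<^bsub>K\<^esub> a v) \<odot>\<^bsub>Z\<^esub> z"
      using p(1) Wc ac cv z by (simp add: Z.smult_r_distr Z.smult_assoc1)
    finally show ?thesis using coeff[of _ "c \<odot>\<^bsub>Z\<^esub> p"] Wsmult p(1) ac cv by simp
  qed
  \<comment> \<open>This reads the coefficient off from \<open>z = 0 + 1 z\<close>.\<close>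
  have "a z = \<one>\<^bsub>K\<^esub>"
    using coeff[of "\<one>\<^bsub>K\<^esub>" "\<zero>\<^bsub>Z\<^esub>" z] W(1) z by (simp add: submodule_def)
  then show thesis
    using f ac by (intro that[of "\<lambda>v. a v \<odot>\<^bsub>F\<^esub> f"])
      (auto simp: module_hom_def add smult F.smult_l_distr F.smult_assoc1)
qed

lemma module_hom_separates:
  assumes Z: "vectorspace K Z" and F: "nonzero_vectorspace K F"
    and uv: "u \<in> carrier Z" "v \<in> carrier Z"
    and eq: "\<And>g. g \<in> module_hom K Z F \<Longrightarrow> g u = g v"
  shows "u = v"
proof (rule ccontr)
  assume "u \<noteq> v"
  interpret Z: vectorspace K Z by (fact Z)
  interpret F: vectorspace K F using F by (simp add: nonzero_vectorspace_def)
  \<comment> \<open>A functional nonzero at \<open>u - v\<close> would distinguish \<open>u\<close>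
    from \<open>v\<close>. The difference is written with the scalar minus one so that additivity
    and homogeneity of \<open>g\<close> apply directly.\<close>
  let ?m = "\<ominus>\<^bsub>K\<^esub> \<one>\<^bsub>K\<^esub>"
  have m: "?m \<odot>\<^bsub>Z\<^esub> v = \<ominus>\<^bsub>Z\<^esub> v" using uv by (simp add: Z.smult_l_minus)
  have "u \<oplus>\<^bsub>Z\<^esub> ?m \<odot>\<^bsub>Z\<^esub> v \<noteq> \<zero>\<^bsub>Z\<^esub>"
    using \<open>u \<noteq> v\<close> uv by (metis m Z.M.minus_equality Z.M.minus_minus Z.M.a_inv_closed)
  then obtain g where g: "g \<in> module_hom K Z F" "g (u \<oplus>\<^bsub>Z\<^esub> ?m \<odot>\<^bsub>Z\<^esub> v) \<noteq> \<zero>\<^bsub>F\<^esub>"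
    using module_hom_nonzero_value[OF Z F] uv by (metis m Z.M.a_inv_closed Z.M.add.m_closed)
  have "g (u \<oplus>\<^bsub>Z\<^esub> ?m \<odot>\<^bsub>Z\<^esub> v) = g u \<oplus>\<^bsub>F\<^esub> ?m \<odot>\<^bsub>F\<^esub> g v"
    using uv by (subst module_homD(2)[OF g(1)]) (auto simp: module_homD(3)[OF g(1)])
  also have "\<dots> = \<zero>\<^bsub>F\<^esub>"
    using eq[OF g(1)] module_homD(1)[OF g(1)] uv by (simp add: F.smult_l_minus F.M.r_neg)
  finally show False using g(2) by simp
qed

section \<open>Spaces of linear and bilinear maps\<close>

lemma carrier_linear_maps:
  "carrier (linear_maps K U Z) = module_hom K U Z \<inter> extensional (carrier U)"
  by (simp add: linear_maps_def pointwise_space_def)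

lemma linear_maps_ops:
  "u \<in> carrier U \<Longrightarrow> \<zero>\<^bsub>linear_maps K U Z\<^esub> u = \<zero>\<^bsub>Z\<^esub>"
  "u \<in> carrier U \<Longrightarrow> (s \<oplus>\<^bsub>linear_maps K U Z\<^esub> t) u = s u \<oplus>\<^bsub>Z\<^esub> t u"
  "u \<in> carrier U \<Longrightarrow> (c \<odot>\<^bsub>linear_maps K U Z\<^esub> t) u = c \<odot>\<^bsub>Z\<^esub> t u"
  by (simp_all add: linear_maps_def pointwise_space_def)

lemma bilinear_mapsD:
  assumes "\<phi> \<in> carrier (bilinear_maps K X Y Z)"
  shows "\<phi> \<in> extensional (carrier X \<times> carrier Y)"
    and "y \<in> carrier Y \<Longrightarrow> (\<lambda>x. \<phi> (x, y)) \<in> module_hom K X Z"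
    and "x \<in> carrier X \<Longrightarrow> (\<lambda>y. \<phi> (x, y)) \<in> module_hom K Y Z"
  using assms by (auto simp: bilinear_maps_def pointwise_space_def)

lemma bilinear_maps_value_closed:
  "\<phi> \<in> carrier (bilinear_maps K X Y Z) \<Longrightarrow> x \<in> carrier X \<Longrightarrow> y \<in> carrier Y
    \<Longrightarrow> \<phi> (x, y) \<in> carrier Z"
  using module_homD(1)[OF bilinear_mapsD(2)] .

text \<open>This makes \<open>g \<circ> \<phi>\<close> a legitimate argument of the functionals in
  the tensor space. The restricted \<open>compose\<close> provides the extensionality that
  \<open>bilinear_maps\<close> demands.\<close>

lemma compose_bilinear_maps:
  assumes X: "vectorspace K X" and Y: "vectorspace K Y"
    and \<phi>: "\<phi> \<in> carrier (bilinear_maps K X Y Z)" and g: "g \<in> module_hom K Z F"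
  shows "compose (carrier X \<times> carrier Y) g \<phi> \<in> carrier (bilinear_maps K X Y F)"
proof -
  interpret X: vectorspace K X by (fact X)
  interpret Y: vectorspace K Y by (fact Y)
  note closed = bilinear_maps_value_closed[OF \<phi>]
  have "(\<lambda>x. compose (carrier X \<times> carrier Y) g \<phi> (x, y)) \<in> module_hom K X F"
    if y: "y \<in> carrier Y" for y
    using closed module_homD[OF g] module_homD(2-)[OF bilinear_mapsD(2)[OF \<phi> y]] y
    by (auto simp: module_hom_def compose_def)
  moreover have "(\<lambda>y. compose (carrier X \<times> carrier Y) g \<phi> (x, y)) \<in> module_hom K Y F"
    if x: "x \<in> carrier X" for x
    using closed module_homD[OF g] module_homD(2-)[OF bilinear_mapsD(3)[OF \<phi> x]] x
    by (auto simp: module_hom_def compose_def)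
  ultimately show ?thesis
    by (simp add: bilinear_maps_def pointwise_space_def compose_def)
qed

section \<open>The span of the single tensors and its universal property\<close>

context
  fixes K :: "('k, 'm) ring_scheme"
    and X :: "('k, 'x, 'n1) module_scheme"
    and Y :: "('k, 'y, 'n2) module_scheme"
    and F :: "('k, 'f, 'n3) module_scheme"
  assumes X: "vectorspace K X" and Y: "vectorspace K Y" and F: "vectorspace K F"
begin

interpretation X: vectorspace K X by (fact X)
interpretation Y: vectorspace K Y by (fact Y)
interpretation F: vectorspace K F by (fact F)
interpretation B: vectorspace K "bilinear_maps K X Y F"
  by (rule vectorspace_bilinear_maps[OF X Y F])
interpretation L: vectorspace K "linear_maps K (bilinear_maps K X Y F) F"
  by (rule vectorspace_linear_maps[OF B.vectorspace_axioms F])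

lemma single_tensors_subset:
  "single_tensors K X Y F \<subseteq> carrier (linear_maps K (bilinear_maps K X Y F) F)"
  using single_tensor_in_linear_maps[OF X Y F] by (auto simp: single_tensors_def)

lemma tensor_space_ops:
  "s \<oplus>\<^bsub>tensor_space K X Y F\<^esub> t = s \<oplus>\<^bsub>linear_maps K (bilinear_maps K X Y F) F\<^esub> t"
  "c \<odot>\<^bsub>tensor_space K X Y F\<^esub> t = c \<odot>\<^bsub>linear_maps K (bilinear_maps K X Y F) F\<^esub> t"
  by (simp_all add: tensor_space_def Let_def)

lemma vectorspace_tensor_space: "vectorspace K (tensor_space K X Y F)"
  using L.subspace_is_vs[OF L.span_is_subspace[OF single_tensors_subset]]
  by (simp add: tensor_space_def Let_def)

lemma single_tensor_in_tensor_space: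
  assumes "x \<in> carrier X" "y \<in> carrier Y"
  shows "single_tensor K X Y F x y \<in> carrier (tensor_space K X Y F)"
  using assms L.in_own_span[OF single_tensors_subset]
  by (auto simp: tensor_space_def Let_def single_tensors_def)

lemma tensor_map_image: "tensor_map K X Y F ` (carrier X \<times> carrier Y) = single_tensors K X Y F"
  by (force simp: tensor_map_def single_tensors_def)

text \<open>The tensor space carries the operations of the ambient space of linear maps, and a span
  computed inside a subspace containing the generators agrees with the ambient span.\<close>

lemma span_tensor_map:
  "LinearCombinations.module.span K (tensor_space K X Y F)
     (tensor_map K X Y F ` (carrier X \<times> carrier Y)) = carrier (tensor_space K X Y F)"
  using L.span_li_not_depend(1)[OF L.in_own_span[OF single_tensors_subset]
      L.span_is_submodule[OF single_tensors_subset]]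
  by (simp add: tensor_map_image tensor_space_def Let_def)

text \<open>Evaluated at a bilinear \<open>\<psi>\<close>, each identity is additivity or
  homogeneity of \<open>\<psi>\<close> in one variable; off the bilinear maps both sides are
  \<open>undefined\<close>.\<close>

lemma tensor_map_bilinear:
  "tensor_map K X Y F \<in> carrier (bilinear_maps K X Y (tensor_space K X Y F))"
proof -
  let ?t = "single_tensor K X Y F" and ?T = "tensor_space K X Y F"
  have l: "?t (x \<oplus>\<^bsub>X\<^esub> x') y = ?t x y \<oplus>\<^bsub>?T\<^esub> ?t x' y"
    "c \<in> carrier K \<Longrightarrow> ?t (c \<odot>\<^bsub>X\<^esub> x) y = c \<odot>\<^bsub>?T\<^esub> ?t x y"
    if "x \<in> carrier X" "x' \<in> carrier X" "y \<in> carrier Y" for x x' y c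
    using that by (auto simp: tensor_space_ops linear_maps_def pointwise_space_def single_tensor_def
        fun_eq_iff module_homD[OF bilinear_mapsD(2)])
  have r: "?t x (y \<oplus>\<^bsub>Y\<^esub> y') = ?t x y \<oplus>\<^bsub>?T\<^esub> ?t x y'"
    "c \<in> carrier K \<Longrightarrow> ?t x (c \<odot>\<^bsub>Y\<^esub> y) = c \<odot>\<^bsub>?T\<^esub> ?t x y"
    if "x \<in> carrier X" "y \<in> carrier Y" "y' \<in> carrier Y" for x y y' c
    using that by (auto simp: tensor_space_ops linear_maps_def pointwise_space_def single_tensor_def
        fun_eq_iff module_homD[OF bilinear_mapsD(3)])
  show ?thesis
    by (auto simp: bilinear_maps_def pointwise_space_def tensor_map_def module_hom_def l r
        single_tensor_in_tensor_space)
qed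

text \<open>The functionals represented by some \<open>z\<close> form a subspace, because
  representing vectors add and scale along with the functionals. It contains every
  \<open>x \<otimes> y\<close>, represented by \<open>\<phi> (x, y)\<close>, hence their
  span.\<close>

lemma tensor_represented:
  assumes Z: "vectorspace K Z" and \<phi>: "\<phi> \<in> carrier (bilinear_maps K X Y Z)"
    and t: "t \<in> carrier (tensor_space K X Y F)"
  shows "\<exists>z\<in>carrier Z. \<forall>g\<in>module_hom K Z F. t (compose (carrier X \<times> carrier Y) g \<phi>) = g z"
proof -
  interpret Z: vectorspace K Z by (fact Z)
  let ?L = "linear_maps K (bilinear_maps K X Y F) F"
  let ?c = "\<lambda>g. compose (carrier X \<times> carrier Y) g \<phi>"
  \<comment> \<open>\<open>?N\<close> is taken inside the full space \<open>?L\<close>, where the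
    span defining the tensor space is formed.\<close>
  let ?N = "{t \<in> carrier ?L. \<exists>z\<in>carrier Z. \<forall>g\<in>module_hom K Z F. t (?c g) = g z}"
  have c: "?c g \<in> carrier (bilinear_maps K X Y F)" if "g \<in> module_hom K Z F" for g
    by (rule compose_bilinear_maps[OF X Y \<phi> that])
  have "single_tensors K X Y F \<subseteq> ?N"
  proof
    fix s assume s: "s \<in> single_tensors K X Y F"
    then obtain x y where xy: "x \<in> carrier X" "y \<in> carrier Y" "s = single_tensor K X Y F x y"
      by (auto simp: single_tensors_def)
    have "s (?c g) = g (\<phi> (x, y))" if "g \<in> module_hom K Z F" for g
      using c[OF that] xy by (simp add: single_tensor_def compose_def)
    then show "s \<in> ?N"
      using s single_tensors_subset bilinear_maps_value_closed[OF \<phi> xy(1,2)] by auto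
  qed
  moreover have "LinearCombinations.submodule K ?N ?L"
    unfolding submodule_def
  proof (intro conjI allI impI)
    fix s t assume "s \<in> ?N" "t \<in> ?N"
    then obtain u v where st: "s \<in> carrier ?L" "t \<in> carrier ?L"
      and uv: "u \<in> carrier Z" "v \<in> carrier Z"
      "\<forall>g\<in>module_hom K Z F. s (?c g) = g u" "\<forall>g\<in>module_hom K Z F. t (?c g) = g v" by blast
    then have "\<forall>g\<in>module_hom K Z F. (s \<oplus>\<^bsub>?L\<^esub> t) (?c g) = g (u \<oplus>\<^bsub>Z\<^esub> v)"
      using c by (simp add: linear_maps_ops module_homD(2))
    then show "s \<oplus>\<^bsub>?L\<^esub> t \<in> ?N" using st uv by blast
  next
    fix a t assume a: "a \<in> carrier K" and "t \<in> ?N"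
    then obtain v where t: "t \<in> carrier ?L"
      and v: "v \<in> carrier Z" "\<forall>g\<in>module_hom K Z F. t (?c g) = g v" by blast
    then have "\<forall>g\<in>module_hom K Z F. (a \<odot>\<^bsub>?L\<^esub> t) (?c g) = g (a \<odot>\<^bsub>Z\<^esub> v)"
      using c a by (simp add: linear_maps_ops module_homD(3))
    then show "a \<odot>\<^bsub>?L\<^esub> t \<in> ?N" using a t v by blast
  next
    \<comment> \<open>Homogeneity with the scalar zero gives this.\<close>
    have "g \<zero>\<^bsub>Z\<^esub> = \<zero>\<^bsub>F\<^esub>" if "g \<in> module_hom K Z F" for g
      using module_homD(1)[OF that, of "\<zero>\<^bsub>Z\<^esub>"] module_homD(3)[OF that, of "\<zero>\<^bsub>K\<^esub>" "\<zero>\<^bsub>Z\<^esub>"] by simp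
    then have "\<forall>g\<in>module_hom K Z F. \<zero>\<^bsub>?L\<^esub> (?c g) = g \<zero>\<^bsub>Z\<^esub>"
      using c by (simp add: linear_maps_ops)
    then show "\<zero>\<^bsub>?L\<^esub> \<in> ?N" by blast
  qed (auto intro: L.module_axioms)
  ultimately have "carrier (tensor_space K X Y F) \<subseteq> ?N"
    using L.span_is_subset by (simp add: tensor_space_def Let_def)
  with t show ?thesis by blast
qed

lemma tensor_factorization:
  assumes nz: "nonzero_vectorspace K F" and Z: "vectorspace K Z"
    and \<phi>: "\<phi> \<in> carrier (bilinear_maps K X Y Z)"
  shows "\<exists>\<Phi>\<in>carrier (linear_maps K (tensor_space K X Y F) Z).
    \<phi> = compose (carrier X \<times> carrier Y) \<Phi> (tensor_map K X Y F)"
proof -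
  interpret Z: vectorspace K Z by (fact Z)
  interpret T: vectorspace K "tensor_space K X Y F" by (rule vectorspace_tensor_space)
  let ?T = "tensor_space K X Y F"
  let ?c = "\<lambda>g. compose (carrier X \<times> carrier Y) g \<phi>"
  have c: "?c g \<in> carrier (bilinear_maps K X Y F)" if "g \<in> module_hom K Z F" for g
    by (rule compose_bilinear_maps[OF X Y \<phi> that])
  \<comment> \<open>\<open>P\<close> picks a representing vector for each tensor; nothing is known
    yet about how the choices fit together.\<close>
  obtain P where P: "\<And>t. t \<in> carrier ?T \<Longrightarrow> P t \<in> carrier Z"
    and Pg: "\<And>t g. t \<in> carrier ?T \<Longrightarrow> g \<in> module_hom K Z F \<Longrightarrow> t (?c g) = g (P t)"
    using tensor_represented[OF Z \<phi>] by metis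
  \<comment> \<open>Separation of points makes the representing vector unique. Additivity,
    homogeneity and the values on the generators all follow by exhibiting a vector that represents
    the tensor in question.\<close>
  have P_eqI: "P t = z"
    if "t \<in> carrier ?T" "z \<in> carrier Z" "\<And>g. g \<in> module_hom K Z F \<Longrightarrow> t (?c g) = g z" for t z
    by (rule module_hom_separates[OF Z nz P[OF that(1)] that(2)])
      (simp add: that(3) flip: Pg[OF that(1)])
  define \<Phi> where "\<Phi> = restrict P (carrier ?T)"
  \<comment> \<open>Operations on tensors are pointwise, so \<open>s + t\<close> takes at
    \<open>?c g\<close> the value \<open>g (P s) + g (P t) = g (P s + P t)\<close>.\<close>
  have "P (s \<oplus>\<^bsub>?T\<^esub> t) = P s \<oplus>\<^bsub>Z\<^esub> P t" if "s \<in> carrier ?T" "t \<in> carrier ?T" for s t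
    using that P c Pg
    by (intro P_eqI) (auto simp: module_homD(2) tensor_space_ops(1) linear_maps_ops
        simp flip: Pg intro: T.M.add.m_closed[unfolded tensor_space_ops(1)])
  moreover have "P (a \<odot>\<^bsub>?T\<^esub> t) = a \<odot>\<^bsub>Z\<^esub> P t" if "a \<in> carrier K" "t \<in> carrier ?T" for a t
    using that P c Pg
    by (intro P_eqI) (auto simp: module_homD(3) tensor_space_ops(2) linear_maps_ops
        simp flip: Pg intro: T.smult_closed[unfolded tensor_space_ops(2)])
  ultimately have "\<Phi> \<in> carrier (linear_maps K ?T Z)"
    using P by (auto simp: carrier_linear_maps module_hom_def \<Phi>_def)
  \<comment> \<open>Evaluating \<open>x \<otimes> y\<close> at \<open>g \<circ> \<phi>\<close> gives
    \<open>g (\<phi> (x, y))\<close>, so \<open>\<phi> (x, y)\<close> is a representing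
    vector.\<close>
  moreover have "P (single_tensor K X Y F x y) = \<phi> (x, y)"
    if "x \<in> carrier X" "y \<in> carrier Y" for x y
    using that c
    by (intro P_eqI single_tensor_in_tensor_space bilinear_maps_value_closed[OF \<phi>])
      (auto simp: single_tensor_def compose_def)
  then have "\<phi> = compose (carrier X \<times> carrier Y) \<Phi> (tensor_map K X Y F)"
    using bilinear_mapsD(1)[OF \<phi>] single_tensor_in_tensor_space
    by (intro extensionalityI[of _ "carrier X \<times> carrier Y"])
      (auto simp: compose_def \<Phi>_def tensor_map_def)
  ultimately show ?thesis by blast
qed

end

theorem theorem5p1:
  fixes K :: "('k, 'm) ring_scheme"
    and X :: "('k, 'x, 'n1) module_scheme"
    and Y :: "('k, 'y, 'n2) module_scheme"
    and F :: "('k, 'f, 'n3) module_scheme"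
  assumes "field K"
    and "nonzero_vectorspace K X"
    and "nonzero_vectorspace K Y"
    and "nonzero_vectorspace K F"
  shows "is_tensor_product TYPE('z) K X Y (tensor_space K X Y F) (tensor_map K X Y F)"
proof -
  have V: "vectorspace K X" "vectorspace K Y" "vectorspace K F"
    using assms by (auto simp: nonzero_vectorspace_def)
  \<comment> \<open>The factorization lemma is polymorphic in the carrier type of \<open>Z\<close>,
    so it can be instantiated at \<open>'z\<close>.\<close>
  show ?thesis
    unfolding is_tensor_product_def
    using assms vectorspace_tensor_space[OF V] tensor_map_bilinear[OF V] span_tensor_map[OF V]
      tensor_factorization[OF V assms(4)]
    by blast
qed

end
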